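(* Let $A \subset \mathbb{R}$ be a countable dense subset of the real line. Then the set $$\mathcal{B} := \{f \in \mathcal{S}^0([0,\infty)) : \limsup_{n \to \infty} \mathrm{K}_M(f,\alpha,n) = \infty \text{ for every } M \in \mathbb{N} \text{ and } \alpha \in A\}$$ is dense and $\mathcal{G}_\delta$ in the space $\mathcal{S}^0([0,\infty))$.
   Context: $\mathcal{S}^0([0,\infty))$ is the set of continuous complex-valued functions $f$ on $[0,\infty)$ such that $\rho_{\ell,0}(f) := \sup_{t \geq 0} t^\ell |f(t)| < \infty$ for every nonnegative integer $\ell$. It is a Fréchet space with the topology induced by the seminorms $\rho_{\ell,0}$, $\ell = 0,1,2,\ldots$. For $f \in \mathcal{S}^0([0,\infty))$ its Fourier-Laplace transform is $\hat{f}(z) = \int_0^\infty e^{-izt} f(t)\,dt$, defined for $z \in \mathbb{C}$ with $\operatorname{Im} z \leq 0$. It is $C^\infty$ on $\{\operatorname{Im} z \leq 0\}$ and holomorphic on $\{\operatorname{Im} z < 0\}$. For $\alpha \in \mathbb{R}$ and $n \in \mathbb{N}=\{1,2,\ldots\}$, $(\hat{f})^{(n)}(\alpha)$ denotes the $n$-th derivative at $x=\alpha$ of the function $x \mapsto \hat f(x)$ of the real variable $x$, i.e. $(\hat{f})^{(n)}(\alpha)=\int_0^\infty e^{-i\alpha t}(-it)^n f(t)\,dt$. For $M \in \mathbb{N} \cup \{0\}$ define $$\mathrm{K}_M(f,\alpha,n) = \frac{1}{n^M} \sqrt[n]{\frac{|(\hat{f})^{(n)}(\alpha)|}{n!}}.$$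 *)

theory Defs
  imports "HOL-Analysis.Analysis"
begin

definition \<rho> :: "nat \<Rightarrow> (real \<Rightarrow> complex) \<Rightarrow> real" where
  "\<rho> l f = (SUP t\<in>{0..}. t ^ l * cmod (f t))"

text \<open>
  Functions on \<open>[0,\<infinity>)\<close> are total functions that are \<open>undefined\<close> outside \<open>{0..}\<close>,
  so that equality in HOL is equality on \<open>[0,\<infinity>)\<close>. Boundedness is required explicitly
  because the real-valued supremum in \<open>\<rho>\<close> is unspecified on unbounded sets.
\<close>

definition S0 :: "(real \<Rightarrow> complex) set" where
  "S0 = {f \<in> extensional {0..}. continuous_on {0..} f \<and>
           (\<forall>l. bdd_above ((\<lambda>t. t ^ l * cmod (f t)) ` {0..}))}"

text \<open>The open balls of the single seminorms form a subbase of the locally convex topology.\<close>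

definition S0_topology :: "(real \<Rightarrow> complex) topology" where
  "S0_topology = topology_generated_by
     {{g \<in> S0. \<rho> l (\<lambda>t. g t - f t) < e} | l f e. f \<in> S0 \<and> e > 0}"

lemma topspace_S0_topology [simp]: "topspace S0_topology = S0"
proof -
  have "f \<in> \<Union> {{g \<in> S0. \<rho> l (\<lambda>t. g t - f t) < e} | l f e. f \<in> S0 \<and> e > 0}"
    if "f \<in> S0" for f
  proof -
    have "\<rho> 0 (\<lambda>t. f t - f t) < 1"
      by (simp add: \<rho>_def)
    with that have "f \<in> {g \<in> S0. \<rho> 0 (\<lambda>t. g t - f t) < 1}"
      by simp
    with that show ?thesis
      using zero_less_one by blast
  qed
  then show ?thesis
    unfolding S0_topology_def topology_generated_by_topspace by blast
qed

definition fourier_laplace :: "(real \<Rightarrow> complex) \<Rightarrow> complex \<Rightarrow> complex" where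
  "fourier_laplace f z = (LINT t:{0..}|lborel. exp (- \<i> * z * of_real t) * f t)"

text \<open>
  The library's \<open>deriv\<close> needs equal argument and value types; derivatives of complex-valued
  functions of a real variable are given by \<open>vector_derivative\<close>.
\<close>

definition nth_real_deriv :: "nat \<Rightarrow> (real \<Rightarrow> complex) \<Rightarrow> real \<Rightarrow> complex" where
  "nth_real_deriv n = (\<lambda>g x. vector_derivative g (at x)) ^^ n"

definition K :: "nat \<Rightarrow> (real \<Rightarrow> complex) \<Rightarrow> real \<Rightarrow> nat \<Rightarrow> real" where
  "K M f \<alpha> n =
     1 / real n ^ M *
     root n (cmod (nth_real_deriv n (\<lambda>x. fourier_laplace f (of_real x)) \<alpha>) / fact n)"

end

theory Submission
  imports Defs
begin

text \<open>
  Differentiating under the integral sign, the \<open>n\<close>-th derivative of the transform at \<open>\<alpha>\<close> is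
  a continuous linear functional of \<open>f\<close>, which makes the set a \<open>G\<^sub>\<delta>\<close>. Density needs no
  completeness. Put narrow bumps at rapidly growing points, the \<open>k\<close>-th one modulated with
  frequency \<open>a k\<close>, where every element of \<open>A\<close> occurs infinitely often among the \<open>a k\<close>. With
  suitable amplitudes their sum \<open>g\<close> is rapidly decreasing, and its derivative of order \<open>2k + 2\<close>
  at \<open>a k\<close> is dominated by the \<open>k\<close>-th bump and as large as we please. If \<open>f + x g\<close> and
  \<open>f + y g\<close> both have finite upper limit at the same \<open>(M, \<alpha>)\<close>, subtracting them bounds the
  derivatives of \<open>g\<close> at \<open>\<alpha>\<close>, so \<open>x = y\<close>. Hence \<open>f + \<epsilon> g\<close> lies in the set for all but countably
  many real \<open>\<epsilon>\<close>.
\<close>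

subsection \<open>Rapidly decreasing functions and derivatives of the transform\<close>

text \<open>Membership in \<open>S0\<close> freed of extensionality: sums and products given by
  plain lambda terms are then covered without restricting them to \<open>{0..}\<close>.\<close>

definition rapid :: "(real \<Rightarrow> complex) \<Rightarrow> bool" where
  "rapid f \<longleftrightarrow> continuous_on {0..} f \<and> (\<forall>l. bdd_above ((\<lambda>t. t ^ l * cmod (f t)) ` {0..}))"

lemma rapid_if_S0: "f \<in> S0 \<Longrightarrow> rapid f"
  by (simp add: S0_def rapid_def)

lemma \<rho>_upper: "rapid f \<Longrightarrow> t \<ge> 0 \<Longrightarrow> t ^ l * cmod (f t) \<le> \<rho> l f"
  unfolding \<rho>_def rapid_def by (rule cSUP_upper) auto

lemma \<rho>_least: "(\<And>t. t \<ge> 0 \<Longrightarrow> t ^ l * cmod (f t) \<le> B) \<Longrightarrow> \<rho> l f \<le> B"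
  unfolding \<rho>_def by (rule cSUP_least) auto

lemma \<rho>_cong: "(\<And>t. t \<ge> 0 \<Longrightarrow> f t = g t) \<Longrightarrow> \<rho> l f = \<rho> l g"
  unfolding \<rho>_def by (rule SUP_cong) auto

lemma \<rho>_nonneg: "rapid f \<Longrightarrow> 0 \<le> \<rho> l f"
  using \<rho>_upper[of f 0 l] by (meson mult_nonneg_nonneg norm_ge_zero order_refl order_trans zero_le_power)

lemma rapidI:
  assumes "continuous_on {0..} f" "\<And>l t. t \<ge> 0 \<Longrightarrow> t ^ l * cmod (f t) \<le> B l"
  shows "rapid f"
  unfolding rapid_def using assms(1)
proof (intro conjI allI)
  show "bdd_above ((\<lambda>t. t ^ l * cmod (f t)) ` {0..})" for l
    by (rule bdd_aboveI2[where M = "B l"]) (use assms(2) in simp)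
qed

lemma rapid_cong:
  assumes "\<And>t. t \<ge> 0 \<Longrightarrow> f t = g t" "rapid f"
  shows "rapid g"
proof (rule rapidI)
  show "continuous_on {0..} g"
    using assms by (simp add: rapid_def cong: continuous_on_cong_simp)
  show "t ^ l * cmod (g t) \<le> \<rho> l f" if "t \<ge> 0" for l t
    using \<rho>_upper[OF assms(2) that] assms(1)[OF that] by simp
qed

lemma
  assumes "rapid f" "rapid g"
  shows rapid_add: "rapid (\<lambda>t. f t + g t)"
    and \<rho>_triangle: "\<rho> l (\<lambda>t. f t + g t) \<le> \<rho> l f + \<rho> l g"
proof -
  have *: "t ^ l * cmod (f t + g t) \<le> \<rho> l f + \<rho> l g" if "t \<ge> 0" for l t
  proof -
    have "t ^ l * cmod (f t + g t) \<le> t ^ l * (cmod (f t) + cmod (g t))"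
      using that by (intro mult_left_mono norm_triangle_ineq) auto
    also have "\<dots> \<le> \<rho> l f + \<rho> l g"
      using \<rho>_upper[OF assms(1) that, of l] \<rho>_upper[OF assms(2) that, of l]
      by (simp add: algebra_simps)
    finally show ?thesis .
  qed
  show "rapid (\<lambda>t. f t + g t)"
    using assms by (intro rapidI[OF _ *] continuous_intros) (auto simp: rapid_def)
  show "\<rho> l (\<lambda>t. f t + g t) \<le> \<rho> l f + \<rho> l g"
    by (rule \<rho>_least[OF *])
qed

text \<open>A factor of growth \<open>C * t ^ n\<close> costs \<open>n\<close> powers of
  \<open>t\<close>. The case \<open>n = 0\<close> gives scalar multiples, \<open>C = 1\<close> the
  moment kernels, and \<open>C = (y - x)\<^sup>2\<close> the Taylor remainder used for
  differentiation.\<close>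

lemma
  assumes f: "rapid f" and h: "continuous_on {0..} h" "\<And>t. t \<ge> 0 \<Longrightarrow> cmod (h t) \<le> C * t ^ n"
  shows rapid_mult: "rapid (\<lambda>t. h t * f t)"
    and \<rho>_mult: "0 \<le> C \<Longrightarrow> \<rho> l (\<lambda>t. h t * f t) \<le> C * \<rho> (l + n) f"
proof -
  have *: "t ^ l * cmod (h t * f t) \<le> C * \<rho> (l + n) f" if "t \<ge> 0" and C: "C \<ge> 0"
    and h: "\<And>t. t \<ge> 0 \<Longrightarrow> cmod (h t) \<le> C * t ^ n" for l t C
  proof -
    have "t ^ l * cmod (h t * f t) \<le> t ^ l * ((C * t ^ n) * cmod (f t))"
      unfolding norm_mult using that by (intro mult_left_mono mult_right_mono h) auto
    also have "\<dots> = C * (t ^ (l + n) * cmod (f t))"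
      by (simp add: power_add)
    also have "\<dots> \<le> C * \<rho> (l + n) f"
      using C \<rho>_upper[OF f \<open>t \<ge> 0\<close>] by (rule mult_left_mono[rotated])
    finally show ?thesis .
  qed
  show "\<rho> l (\<lambda>t. h t * f t) \<le> C * \<rho> (l + n) f" if "0 \<le> C"
    by (rule \<rho>_least[OF *]) (use h that in auto)
  have "cmod (h t) \<le> \<bar>C\<bar> * t ^ n" if "t \<ge> 0" for t
    using h(2)[OF that] that by (meson abs_ge_self mult_right_mono order_trans zero_le_power)
  moreover have "continuous_on {0..} (\<lambda>t. h t * f t)"
    using f h(1) unfolding rapid_def by (blast intro: continuous_on_mult)
  ultimately show "rapid (\<lambda>t. h t * f t)"
    by (intro rapidI[where B = "\<lambda>l. \<bar>C\<bar> * \<rho> (l + n) f"] *) simp_all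
qed

lemma rapid_cmult: "rapid f \<Longrightarrow> rapid (\<lambda>t. c * f t)"
  using rapid_mult[of f "\<lambda>_. c" "cmod c" 0] by simp

lemma \<rho>_cmult: "rapid f \<Longrightarrow> \<rho> l (\<lambda>t. c * f t) \<le> cmod c * \<rho> l f"
  using \<rho>_mult[of f "\<lambda>_. c" "cmod c" 0 l] by simp

lemma rapid_diff: "rapid f \<Longrightarrow> rapid g \<Longrightarrow> rapid (\<lambda>t. f t - g t)"
  using rapid_add[of f "\<lambda>t. (-1) * g t"] rapid_cmult[of g "-1"] by simp

text \<open>\<open>arctan\<close> is an antiderivative. The weight dominates rapidly decreasing
  functions and is the source of the factor \<open>pi / 2\<close> in later bounds.\<close>

lemma has_bochner_integral_inverse_1_plus_square:
  "has_bochner_integral lborel (\<lambda>t::real. indicator {0..} t *\<^sub>R inverse (1 + t\<^sup>2)) (pi / 2)"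
proof -
  have "(\<integral>\<^sup>+x. ennreal (inverse (1 + x\<^sup>2)) * indicator {0..} x \<partial>lborel) = ennreal (pi / 2 - arctan 0)"
    using DERIV_arctan tendsto_arctan_at_top by (intro nn_integral_FTC_atLeast) auto
  moreover have "ennreal (indicator {0..} x *\<^sub>R inverse (1 + x\<^sup>2))
      = ennreal (inverse (1 + x\<^sup>2)) * indicator {0..} x" for x :: real
    by (simp split: split_indicator)
  ultimately show ?thesis
    by (intro has_bochner_integral_nn_integral) simp_all
qed

text \<open>The seminorms of index 0 and 2 together bound
  \<open>(1 + t\<^sup>2) * cmod (f t)\<close>, so \<open>f\<close> is dominated by a multiple of an
  integrable weight.\<close>

lemma
  assumes f: "rapid f"
  shows set_integrable_rapid: "set_integrable lborel {0..} f"
    and norm_set_integral_rapid_le: "cmod (LINT t:{0..}|lborel. f t) \<le> pi / 2 * (\<rho> 0 f + \<rho> 2 f)"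
proof -
  let ?w = "\<lambda>t::real. indicator {0..} t *\<^sub>R inverse (1 + t\<^sup>2)"
  let ?C = "\<rho> 0 f + \<rho> 2 f"
  have bound: "norm (indicator {0..} t *\<^sub>R f t) \<le> ?C * ?w t" for t
  proof (cases "t \<ge> 0")
    case True
    have "(1 + t\<^sup>2) * cmod (f t) \<le> ?C"
      using \<rho>_upper[OF f True, of 0] \<rho>_upper[OF f True, of 2] by (simp add: algebra_simps)
    moreover have "1 + t\<^sup>2 > 0"
      by (simp add: add_pos_nonneg)
    ultimately have "cmod (f t) \<le> ?C * inverse (1 + t\<^sup>2)"
      by (simp add: field_simps)
    with True show ?thesis
      by simp
  qed auto
  have int: "integrable lborel (\<lambda>t. ?C * ?w t)"
    using has_bochner_integral_inverse_1_plus_square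
    by (intro integrable_mult_right) (simp add: has_bochner_integral_iff)
  have "(\<lambda>t. indicator {0..} t *\<^sub>R f t) \<in> borel_measurable lborel"
    using f borel_measurable_continuous_on_indicator[of "{0..}" f] by (simp add: rapid_def)
  with int show "set_integrable lborel {0..} f"
    unfolding set_integrable_def by (rule Bochner_Integration.integrable_bound)
      (use bound in \<open>fastforce intro: order_trans\<close>)
  have "norm (\<integral>t. indicator {0..} t *\<^sub>R f t \<partial>lborel) \<le> (\<integral>t. ?C * ?w t \<partial>lborel)"
    using \<open>set_integrable lborel {0..} f\<close> int bound
    unfolding set_integrable_def by (intro Bochner_Integration.integral_norm_bound_integral)
  then have "cmod (LINT t:{0..}|lborel. f t) \<le> (\<integral>t. ?C * ?w t \<partial>lborel)"
    by (simp only: set_lebesgue_integral_def)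
  also have "\<dots> = ?C * (pi / 2)"
    using has_bochner_integral_inverse_1_plus_square by (simp add: has_bochner_integral_iff)
  finally show "cmod (LINT t:{0..}|lborel. f t) \<le> pi / 2 * ?C"
    by (simp add: mult.commute)
qed

section \<open>Moments as derivatives of the transform\<close>

definition moment_kernel :: "nat \<Rightarrow> real \<Rightarrow> real \<Rightarrow> complex" where
  "moment_kernel n \<alpha> t = exp (- \<i> * of_real \<alpha> * of_real t) * (- \<i> * of_real t) ^ n"

text \<open>The factor \<open>moment_kernel n \<alpha> t\<close> is the n-th derivative of exp(-i
  \<alpha> t) in \<alpha>, so this is the expected n-th derivative of the transform;
  \<open>nth_real_deriv_fourier_laplace\<close> confirms it.\<close>

definition moment :: "nat \<Rightarrow> real \<Rightarrow> (real \<Rightarrow> complex) \<Rightarrow> complex" where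
  "moment n \<alpha> f = (LINT t:{0..}|lborel. moment_kernel n \<alpha> t * f t)"

lemma norm_moment_kernel: "t \<ge> 0 \<Longrightarrow> cmod (moment_kernel n \<alpha> t) = t ^ n"
  by (simp add: moment_kernel_def norm_mult norm_power)

lemma continuous_on_moment_kernel: "continuous_on S (moment_kernel n \<alpha>)"
  unfolding moment_kernel_def by (intro continuous_intros)

lemma rapid_moment_kernel: "rapid f \<Longrightarrow> rapid (\<lambda>t. moment_kernel n \<alpha> t * f t)"
  by (rule rapid_mult[where C = 1 and n = n])
    (simp_all add: norm_moment_kernel continuous_on_moment_kernel)

text \<open>The kernel has modulus \<open>t ^ n\<close>, which raises the indices 0 and 2 of the
  integral estimate by \<open>n\<close>. This is what makes moments continuous on
  \<open>S0\<close>.\<close>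

lemma norm_moment_le:
  assumes "rapid f"
  shows "cmod (moment n \<alpha> f) \<le> pi / 2 * (\<rho> n f + \<rho> (n + 2) f)"
proof -
  have "\<rho> l (\<lambda>t. moment_kernel n \<alpha> t * f t) \<le> \<rho> (l + n) f" for l
    using \<rho>_mult[OF assms continuous_on_moment_kernel, of n \<alpha> 1 n l]
    by (auto simp: norm_moment_kernel)
  from this[of 0] this[of 2] show ?thesis
    unfolding moment_def
    by (intro order_trans[OF norm_set_integral_rapid_le[OF rapid_moment_kernel[OF assms]]]
        mult_left_mono add_mono) (auto simp: add.commute)
qed

lemma moment_cong: "(\<And>t. t \<ge> 0 \<Longrightarrow> f t = g t) \<Longrightarrow> moment n \<alpha> f = moment n \<alpha> g"
  unfolding moment_def by (rule set_lebesgue_integral_cong) auto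

lemma moment_add:
  "rapid f \<Longrightarrow> rapid g \<Longrightarrow> moment n \<alpha> (\<lambda>t. f t + g t) = moment n \<alpha> f + moment n \<alpha> g"
  unfolding moment_def distrib_left
  by (intro set_integral_add set_integrable_rapid rapid_moment_kernel)

lemma moment_cmult: "moment n \<alpha> (\<lambda>t. c * f t) = c * moment n \<alpha> f"
proof -
  have "moment n \<alpha> (\<lambda>t. c * f t) = (LINT t:{0..}|lborel. c * (moment_kernel n \<alpha> t * f t))"
    unfolding moment_def by (simp add: mult_ac)
  then show ?thesis
    by (simp add: moment_def)
qed

lemma moment_diff:
  assumes "rapid f" "rapid g"
  shows "moment n \<alpha> (\<lambda>t. f t - g t) = moment n \<alpha> f - moment n \<alpha> g"
  unfolding moment_def right_diff_distrib
  by (intro set_integral_diff set_integrable_rapid rapid_moment_kernel assms)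

text \<open>On the imaginary axis the factor exp |Re z| of the Taylor remainder is 1, so the bound
  holds for all real \<open>u\<close>, not only near 0.\<close>

lemma norm_exp_ii_minus_taylor1_le:
  fixes u :: real
  shows "cmod (exp (\<i> * of_real u) - 1 - \<i> * of_real u) \<le> u\<^sup>2"
  using Taylor_exp[of "\<i> * of_real u" 1]
  by (simp add: diff_diff_eq norm_mult power2_eq_square)

text \<open>Changing the frequency from \<open>x\<close> to \<open>y\<close> multiplies the kernel
  by exp(i u) with u = -(y - x) t, and the term linear in u yields the kernel of order
  \<open>Suc n\<close>. What remains is a Taylor remainder times a factor of modulus
  \<open>t ^ n\<close>.\<close>

lemma norm_moment_kernel_taylor1_le:
  assumes "t \<ge> 0"
  shows "cmod (moment_kernel n y t - moment_kernel n x t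
           - of_real (y - x) * moment_kernel (Suc n) x t) \<le> (y - x)\<^sup>2 * t ^ (n + 2)"
proof -
  let ?u = "- (y - x) * t"
  have "moment_kernel n y t = moment_kernel n x t * exp (\<i> * of_real ?u)"
    unfolding moment_kernel_def by (simp add: exp_minus exp_diff field_simps)
  then have "moment_kernel n y t - moment_kernel n x t - of_real (y - x) * moment_kernel (Suc n) x t
      = moment_kernel n x t * (exp (\<i> * of_real ?u) - 1 - \<i> * of_real ?u)"
    unfolding moment_kernel_def by (simp add: algebra_simps)
  also have "cmod \<dots> = t ^ n * cmod (exp (\<i> * of_real ?u) - 1 - \<i> * of_real ?u)"
    using assms by (simp only: norm_mult norm_moment_kernel)
  also have "\<dots> \<le> t ^ n * ?u\<^sup>2"
    using assms norm_exp_ii_minus_taylor1_le[of ?u] by (intro mult_left_mono) auto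
  finally show ?thesis
    by (simp add: power_mult_distrib power2_eq_square algebra_simps)
qed

text \<open>Integrating the pointwise Taylor bound against \<open>f\<close> gives an error quadratic
  in \<open>y - x\<close>; the decay of \<open>f\<close> pays for the factor
  \<open>t ^ (n + 2)\<close>.\<close>

lemma has_vector_derivative_moment:
  assumes f: "rapid f"
  shows "((\<lambda>x. moment n x f) has_vector_derivative moment (Suc n) x f) (at x)"
proof -
  \<comment> \<open>Indices 0 and 2 of the integral estimate, each raised by the
    \<open>n + 2\<close> powers of \<open>t\<close> in the Taylor bound.\<close>
  define C where "C = pi / 2 * (\<rho> (n + 2) f + \<rho> (n + 4) f)"
  have C: "C \<ge> 0"
    using \<rho>_nonneg[OF f] by (auto simp: C_def)
  have quad: "cmod (moment n y f - moment n x f - (y - x) *\<^sub>R moment (Suc n) x f) \<le> (y - x)\<^sup>2 * C" for y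
  proof -
    define k where "k t = moment_kernel n y t - moment_kernel n x t
           - of_real (y - x) * moment_kernel (Suc n) x t" for t
    have k: "continuous_on {0..} k"
      unfolding k_def by (intro continuous_intros continuous_on_moment_kernel)
    have kb: "cmod (k t) \<le> (y - x)\<^sup>2 * t ^ (n + 2)" if "t \<ge> 0" for t
      unfolding k_def using norm_moment_kernel_taylor1_le[OF that] by blast
    note int = set_integrable_rapid[OF rapid_moment_kernel[OF f]]
    have "moment n y f - moment n x f - (y - x) *\<^sub>R moment (Suc n) x f
        = (LINT t:{0..}|lborel. k t * f t)"
      unfolding moment_def k_def left_diff_distrib mult.assoc scaleR_conv_of_real
      using int by (simp add: set_integral_diff)
    also have "cmod \<dots> \<le> pi / 2 * (\<rho> 0 (\<lambda>t. k t * f t) + \<rho> 2 (\<lambda>t. k t * f t))"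
      by (rule norm_set_integral_rapid_le[OF rapid_mult[OF f k kb]])
    also have "\<dots> \<le> pi / 2 * ((y - x)\<^sup>2 * \<rho> (n + 2) f + (y - x)\<^sup>2 * \<rho> (n + 4) f)"
      using \<rho>_mult[OF f k kb, of 0] \<rho>_mult[OF f k kb, of 2]
      by (intro mult_left_mono add_mono) (auto simp: add.commute[of _ n] numeral_eq_Suc)
    finally show ?thesis
      by (simp add: C_def algebra_simps)
  qed
  show ?thesis
    unfolding has_vector_derivative_def
  proof (rule has_derivativeI_sandwich[of 1])
    have "((\<lambda>y. \<bar>y - x\<bar> * C) \<longlongrightarrow> \<bar>x - x\<bar> * C) (at x)"
      by (intro tendsto_intros)
    then show "((\<lambda>y. \<bar>y - x\<bar> * C) \<longlongrightarrow> 0) (at x)"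
      by simp
    fix y assume "y \<noteq> x"
    moreover have "norm (moment n y f - moment n x f - (y - x) *\<^sub>R moment (Suc n) x f)
        \<le> (\<bar>y - x\<bar> * C) * norm (y - x)"
    proof -
      have "(y - x)\<^sup>2 * C = (\<bar>y - x\<bar> * C) * norm (y - x)"
        by (simp add: power2_eq_square)
      with quad[of y] show ?thesis
        by (simp only:)
    qed
    ultimately show "norm (moment n y f - moment n x f - (y - x) *\<^sub>R moment (Suc n) x f)
        / norm (y - x) \<le> \<bar>y - x\<bar> * C"
      by (simp add: pos_divide_le_eq)
  qed (auto intro: bounded_linear_scaleR_left)
qed

text \<open>The equality is one of functions of \<open>x\<close>, so that the induction step can
  differentiate it.\<close>

lemma nth_real_deriv_fourier_laplace:
  assumes "rapid f"
  shows "nth_real_deriv n (\<lambda>x. fourier_laplace f (of_real x)) = (\<lambda>x. moment n x f)"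
proof (induction n)
  case 0
  show ?case
    by (simp add: nth_real_deriv_def fourier_laplace_def moment_def moment_kernel_def)
next
  case (Suc n)
  then show ?case
    using vector_derivative_at[OF has_vector_derivative_moment[OF assms]]
    by (simp add: nth_real_deriv_def)
qed

lemma K_eq: "f \<in> S0 \<Longrightarrow> K M f \<alpha> n = 1 / real n ^ M * root n (cmod (moment n \<alpha> f) / fact n)"
  unfolding K_def nth_real_deriv_fourier_laplace[OF rapid_if_S0] ..

subsection \<open>A sum of modulated bumps with large derivatives\<close>

text \<open>A parabolic arch over \<open>[a, a + 1]\<close>, cut off at 0 to stay continuous; the
  factor 6 gives it integral 1.\<close>

definition bump :: "real \<Rightarrow> real \<Rightarrow> real" where
  "bump a t = 6 * max 0 ((t - a) * (1 - (t - a)))"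

lemma bump_nonneg: "bump a t \<ge> 0"
  by (simp add: bump_def)

lemma bump_eq_0: "t \<notin> {a..a + 1} \<Longrightarrow> bump a t = 0"
  by (auto simp: bump_def max_def mult_le_0_iff zero_le_mult_iff)

lemma bump_le: "bump a t \<le> 6"
proof -
  have "(t - a) * (1 - (t - a)) \<le> 1"
    using zero_le_power2[of "t - a - 1"] zero_le_power2[of "t - a"]
    by (simp add: power2_eq_square algebra_simps)
  then show ?thesis
    by (simp add: bump_def)
qed

lemma continuous_on_bump: "continuous_on S (bump a)"
  unfolding bump_def by (intro continuous_intros)

lemma has_bochner_integral_bump: "has_bochner_integral lborel (bump a) 1"
proof -
  \<comment> \<open>With s = t - a this is 3 s^2 - 2 s^3, an antiderivative of 6 s (1 - s) that runs
    from 0 to 1 over the support.\<close>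
  let ?F = "\<lambda>t. 3 * (t - a)\<^sup>2 - 2 * (t - a) ^ 3"
  have "has_bochner_integral lborel (\<lambda>t. bump a t * indicator {a..a + 1} t) (?F (a + 1) - ?F a)"
  proof (rule has_bochner_integral_FTC_Icc_nonneg)
    show "bump a \<in> borel_measurable borel"
      by (intro borel_measurable_continuous_onI continuous_on_bump)
    fix t assume "t \<in> {a..a + 1}"
    then have "bump a t = 6 * ((t - a) * (1 - (t - a)))"
      by (simp add: bump_def)
    moreover have "DERIV ?F t :> 6 * ((t - a) * (1 - (t - a)))"
      by (auto intro!: derivative_eq_intros simp: power2_eq_square algebra_simps)
    ultimately show "DERIV ?F t :> bump a t"
      by simp
  qed (auto simp: bump_nonneg)
  moreover have "(\<lambda>t. bump a t * indicator {a..a + 1} t) = bump a"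
    using bump_eq_0 by (auto simp: fun_eq_iff split: split_indicator)
  ultimately show ?thesis
    by simp
qed

section \<open>Moments of one bump\<close>

definition bump_moment :: "nat \<Rightarrow> real \<Rightarrow> real" where
  "bump_moment n a = (\<integral>t. t ^ n * bump a t \<partial>lborel)"

text \<open>On the support \<open>a \<le> t \<le> a + 1 \<le> 2 * a\<close>, the last step by
  \<open>a \<ge> 1\<close>; elsewhere both sides vanish.\<close>

lemma power_bump_bounds:
  assumes "a \<ge> 1"
  shows "a ^ n * bump a t \<le> t ^ n * bump a t"
    and "\<bar>t\<bar> ^ n * bump a t \<le> (2 * a) ^ n * bump a t"
proof -
  have "t \<in> {a..a + 1} \<or> bump a t = 0"
    using bump_eq_0 by blast
  then have "bump a t = 0 \<or> a ^ n \<le> t ^ n \<and> \<bar>t\<bar> ^ n \<le> (2 * a) ^ n"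
    using assms power_mono[of a t n] power_mono[of "\<bar>t\<bar>" "2 * a" n] by auto
  then show "a ^ n * bump a t \<le> t ^ n * bump a t"
    and "\<bar>t\<bar> ^ n * bump a t \<le> (2 * a) ^ n * bump a t"
    using bump_nonneg[of a t] by (metis mult_right_mono mult_zero_right order_refl)+
qed

lemma integrable_power_bump: "a \<ge> 1 \<Longrightarrow> integrable lborel (\<lambda>t. t ^ n * bump a t)"
proof (rule Bochner_Integration.integrable_bound)
  show "integrable lborel (\<lambda>t. (2 * a) ^ n * bump a t)"
    using has_bochner_integral_bump by (intro integrable_mult_right) (simp add: has_bochner_integral_iff)
  show "(\<lambda>t. t ^ n * bump a t) \<in> borel_measurable lborel"
    unfolding measurable_lborel2
    by (intro borel_measurable_continuous_onI continuous_intros continuous_on_bump)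
  show "AE t in lborel. norm (t ^ n * bump a t) \<le> norm ((2 * a) ^ n * bump a t)" if "a \<ge> 1"
    using power_bump_bounds(2)[OF that] that
    by (intro AE_I2) (simp add: abs_mult power_abs bump_nonneg)
qed

lemma bump_moment_bounds:
  assumes "a \<ge> 1"
  shows "a ^ n \<le> bump_moment n a" "bump_moment n a \<le> (2 * a) ^ n"
proof -
  have b: "integrable lborel (bump a)" "integral\<^sup>L lborel (bump a) = 1"
    using has_bochner_integral_bump[of a] by (simp_all add: has_bochner_integral_iff)
  have "(\<integral>t. a ^ n * bump a t \<partial>lborel) \<le> bump_moment n a"
    unfolding bump_moment_def using b integrable_power_bump[OF assms] power_bump_bounds(1)[OF assms]
    by (intro integral_mono) auto
  with b show "a ^ n \<le> bump_moment n a"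
    by simp
  have "t ^ n * bump a t \<le> (2 * a) ^ n * bump a t" for t
    using power_bump_bounds(2)[OF assms, where n = n and t = t] bump_nonneg[of a t]
    by (metis abs_ge_self mult_right_mono order_trans power_abs)
  then have "bump_moment n a \<le> (\<integral>t. (2 * a) ^ n * bump a t \<partial>lborel)"
    unfolding bump_moment_def using b integrable_power_bump[OF assms]
    by (intro integral_mono) auto
  with b show "bump_moment n a \<le> (2 * a) ^ n"
    by simp
qed

text \<open>
  The recursion makes \<open>bump_pos k\<close> exceed the total contribution of the earlier bumps to the
  moment of order \<open>2k + 2\<close> by the growth wanted there; \<open>8 ^ k\<close> makes the later contributions summable.
\<close>

fun bump_pos :: "nat \<Rightarrow> real" where
  "bump_pos k = (\<Sum>j<k. (2 * bump_pos j) ^ (2 * k + 2)) + 8 ^ k + 3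
     + fact (2 * k + 2) * real (2 * k + 2) ^ (k * (2 * k + 2))"

declare bump_pos.simps [simp del]

lemma bump_pos_ge: "bump_pos k \<ge> 8 ^ k + 3"
proof (induction k rule: less_induct)
  case (less k)
  have "0 \<le> bump_pos j" if "j < k" for j
    using less[OF that] zero_le_power[of "8::real" j] by linarith
  then have "0 \<le> (\<Sum>j<k. (2 * bump_pos j) ^ (2 * k + 2))"
    by (intro sum_nonneg zero_le_power) auto
  moreover have "0 \<le> fact (2 * k + 2) * real (2 * k + 2) ^ (k * (2 * k + 2))"
    by simp
  ultimately show ?case
    unfolding bump_pos.simps[of k] by linarith
qed

lemma bump_pos_ge1: "bump_pos k \<ge> 1"
  using bump_pos_ge[of k] zero_le_power[of "8::real" k] by linarith

text \<open>The exponent separates the orders: apart from powers of 2, moments of order at most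
  \<open>2 * k\<close> are damped by at least one power of \<open>bump_pos k\<close>, while order
  \<open>2 * k + 2\<close> retains exactly one.\<close>

definition amp :: "nat \<Rightarrow> real" where
  "amp k = inverse (bump_pos k ^ (2 * k + 1))"

lemma amp_pos: "amp k > 0"
  using bump_pos_ge1[of k] by (simp add: amp_def)

text \<open>One power of \<open>bump_pos k \<ge> 8 ^ k\<close> is left in the denominator and beats
  the \<open>4 ^ k\<close> coming from the doubled base.\<close>

lemma amp_power_le:
  assumes "n \<le> 2 * k"
  shows "amp k * (2 * bump_pos k) ^ n \<le> inverse (2 ^ k)"
proof -
  have p: "bump_pos k \<ge> 1" by (rule bump_pos_ge1)
  have "(2 * bump_pos k) ^ n \<le> (2 * bump_pos k) ^ (2 * k)"
    using p assms by (intro power_increasing) auto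
  also have "\<dots> = 4 ^ k * bump_pos k ^ (2 * k)"
    by (simp add: power_mult_distrib power_mult)
  finally have "amp k * (2 * bump_pos k) ^ n \<le> amp k * (4 ^ k * bump_pos k ^ (2 * k))"
    using amp_pos[of k] by simp
  also have "\<dots> = 4 ^ k / bump_pos k"
    using p by (simp add: amp_def field_simps)
  also have "\<dots> \<le> 4 ^ k / 8 ^ k"
    using bump_pos_ge[of k] p by (intro divide_left_mono) (auto intro: order_trans mult_pos_pos)
  also have "\<dots> = inverse (2 ^ k)"
    by (simp add: power_divide[symmetric] inverse_eq_divide power_one_over)
  finally show ?thesis .
qed

text \<open>For fixed \<open>n\<close> the condition \<open>n \<le> 2 * k\<close> holds from
  \<open>k = n\<close> on, and that tail is dominated by a geometric series.\<close>

lemma summable_amp_power: "summable (\<lambda>k. amp k * (2 * bump_pos k) ^ n)"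
proof (rule summable_comparison_test'[where N = n])
  show "summable (\<lambda>k. (1 / 2) ^ k :: real)"
    by (intro summable_geometric) auto
  fix k assume "k \<ge> n"
  then show "norm (amp k * (2 * bump_pos k) ^ n) \<le> (1 / 2) ^ k"
    using amp_power_le[of n k] amp_pos[of k] bump_pos_ge1[of k]
    by (simp add: power_one_over inverse_eq_divide abs_mult)
qed

section \<open>Modulated bumps and the convergence of their sum\<close>

definition wave :: "(nat \<Rightarrow> real) \<Rightarrow> nat \<Rightarrow> real \<Rightarrow> complex" where
  "wave a k t = of_real (amp k * bump (bump_pos k) t) * exp (\<i> * of_real (a k) * of_real t)"

definition wave_sum :: "(nat \<Rightarrow> real) \<Rightarrow> real \<Rightarrow> complex" where
  "wave_sum a t = (\<Sum>k. wave a k t)"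

lemma norm_wave: "cmod (wave a k t) = amp k * bump (bump_pos k) t"
  using amp_pos[of k] bump_nonneg[of "bump_pos k" t] by (simp add: wave_def norm_mult)

lemma power_norm_wave_le:
  "\<bar>t\<bar> ^ l * cmod (wave a k t) \<le> amp k * ((2 * bump_pos k) ^ l * bump (bump_pos k) t)"
proof -
  have "\<bar>t\<bar> ^ l * cmod (wave a k t) = amp k * (\<bar>t\<bar> ^ l * bump (bump_pos k) t)"
    by (simp add: norm_wave)
  also have "\<dots> \<le> amp k * ((2 * bump_pos k) ^ l * bump (bump_pos k) t)"
    using amp_pos[of k] power_bump_bounds(2)[OF bump_pos_ge1] by (intro mult_left_mono) auto
  finally show ?thesis .
qed

lemma power_norm_wave_le':
  "\<bar>t\<bar> ^ l * cmod (wave a k t) \<le> 6 * (amp k * (2 * bump_pos k) ^ l)"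
proof -
  have "(2 * bump_pos k) ^ l * bump (bump_pos k) t \<le> (2 * bump_pos k) ^ l * 6"
    using bump_le bump_pos_ge1[of k] by (intro mult_left_mono) auto
  then have "amp k * ((2 * bump_pos k) ^ l * bump (bump_pos k) t) \<le> amp k * ((2 * bump_pos k) ^ l * 6)"
    using amp_pos[of k] by (rule mult_left_mono[OF _ less_imp_le])
  with power_norm_wave_le[of t l a k] show ?thesis
    by (simp add: mult_ac)
qed

lemma continuous_on_wave: "continuous_on S (wave a k)"
  unfolding wave_def by (intro continuous_intros continuous_on_bump)

lemma rapid_wave: "rapid (wave a k)"
  using power_norm_wave_le'[of _ _ a k]
  by (intro rapidI[OF continuous_on_wave, where B = "\<lambda>l. 6 * (amp k * (2 * bump_pos k) ^ l)"])
    (metis abs_of_nonneg)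

lemma summable_power_norm_wave: "summable (\<lambda>k. \<bar>t\<bar> ^ l * cmod (wave a k t))"
  using power_norm_wave_le'[of t l a]
  by (intro summable_comparison_test'[OF summable_mult[OF summable_amp_power[of l], of 6], of 0]) auto

lemma summable_norm_wave: "summable (\<lambda>k. cmod (wave a k t))"
  using summable_power_norm_wave[of t 0 a] by simp

lemma rapid_wave_sum: "rapid (wave_sum a)"
proof (rule rapidI)
  \<comment> \<open>With weight exponent 0 the bound on the waves does not depend on
    \<open>t\<close>, as the M-test requires; uniform convergence then gives continuity of the
    sum.\<close>
  have "uniform_limit {0..} (\<lambda>n t. \<Sum>k<n. wave a k t) (\<lambda>t. \<Sum>k. wave a k t) sequentially"
    using power_norm_wave_le'[of _ 0 a] summable_mult[OF summable_amp_power[of 0], of 6]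
    by (intro Weierstrass_m_test[where M = "\<lambda>k. 6 * (amp k * (2 * bump_pos k) ^ 0)"]) auto
  then show "continuous_on {0..} (wave_sum a)"
    unfolding wave_sum_def[abs_def]
    by (rule uniform_limit_theorem[rotated])
      (auto intro!: always_eventually continuous_on_sum continuous_on_wave)
  fix l and t :: real assume "t \<ge> 0"
  have "t ^ l * cmod (wave_sum a t) \<le> t ^ l * (\<Sum>k. cmod (wave a k t))"
    unfolding wave_sum_def using \<open>t \<ge> 0\<close>
    by (intro mult_left_mono summable_norm summable_norm_wave) auto
  also have "\<dots> = (\<Sum>k. \<bar>t\<bar> ^ l * cmod (wave a k t))"
    using \<open>t \<ge> 0\<close> by (simp add: suminf_mult[OF summable_norm_wave])
  also have "\<dots> \<le> (\<Sum>k. 6 * (amp k * (2 * bump_pos k) ^ l))"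
    by (intro suminf_le power_norm_wave_le' summable_power_norm_wave summable_mult summable_amp_power)
  finally show "t ^ l * cmod (wave_sum a t) \<le> (\<Sum>k. 6 * (amp k * (2 * bump_pos k) ^ l))" .
qed

text \<open>Each bump sits in \<open>t \<ge> 1\<close>, where the phases have modulus 1 and the
  kernel has modulus \<open>t ^ n\<close>; so the integrals can be taken over the whole
  line.\<close>

lemma
  shows integrable_moment_wave: "integrable lborel (\<lambda>t. moment_kernel n \<alpha> t * wave a k t)"
    and integral_norm_moment_wave:
      "(\<integral>t. cmod (moment_kernel n \<alpha> t * wave a k t) \<partial>lborel) = amp k * bump_moment n (bump_pos k)"
proof -
  have eq: "cmod (moment_kernel n \<alpha> t * wave a k t) = amp k * (t ^ n * bump (bump_pos k) t)" for t
  proof (cases "t \<ge> 0")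
    case False
    then have "bump (bump_pos k) t = 0"
      using bump_pos_ge1[of k] by (intro bump_eq_0) auto
    then show ?thesis
      by (simp add: wave_def)
  qed (simp add: norm_mult norm_moment_kernel norm_wave)
  have int: "integrable lborel (\<lambda>t. amp k * (t ^ n * bump (bump_pos k) t))"
    by (intro integrable_mult_right integrable_power_bump bump_pos_ge1)
  show "integrable lborel (\<lambda>t. moment_kernel n \<alpha> t * wave a k t)"
  proof (rule Bochner_Integration.integrable_bound[OF int])
    show "(\<lambda>t. moment_kernel n \<alpha> t * wave a k t) \<in> borel_measurable lborel"
      unfolding measurable_lborel2
      by (intro borel_measurable_continuous_onI continuous_on_mult continuous_on_moment_kernel continuous_on_wave)
  qed (simp add: eq)
  show "(\<integral>t. cmod (moment_kernel n \<alpha> t * wave a k t) \<partial>lborel) = amp k * bump_moment n (bump_pos k)"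
    by (simp add: eq bump_moment_def)
qed

lemma wave_eq_0: "t < 0 \<Longrightarrow> wave a k t = 0"
  using bump_pos_ge1[of k] by (simp add: wave_def bump_eq_0)

lemma moment_wave: "moment n \<alpha> (wave a k) = (\<integral>t. moment_kernel n \<alpha> t * wave a k t \<partial>lborel)"
  unfolding moment_def set_lebesgue_integral_def
  by (intro Bochner_Integration.integral_cong) (auto simp: wave_eq_0 split: split_indicator)

lemma norm_moment_wave_le: "cmod (moment n \<alpha> (wave a k)) \<le> amp k * (2 * bump_pos k) ^ n"
proof -
  have "cmod (moment n \<alpha> (wave a k)) \<le> amp k * bump_moment n (bump_pos k)"
    unfolding moment_wave integral_norm_moment_wave[of n \<alpha> a k, symmetric]
    by (rule integral_norm_bound)
  also have "\<dots> \<le> amp k * (2 * bump_pos k) ^ n"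
    using bump_moment_bounds(2)[OF bump_pos_ge1] amp_pos[of k] by (intro mult_left_mono) auto
  finally show ?thesis .
qed

text \<open>At the frequency \<open>a k\<close> the modulation cancels the oscillation of the
  kernel. A nonnegative integrand times a constant of modulus \<open>amp k\<close> remains, so
  nothing is lost to cancellation.\<close>

lemma norm_moment_wave_ge: "amp k * bump_pos k ^ n \<le> cmod (moment n (a k) (wave a k))"
proof -
  have "moment_kernel n (a k) t * wave a k t
      = of_real (t ^ n * bump (bump_pos k) t) * ((- \<i>) ^ n * of_real (amp k))" for t
  proof -
    have "(- \<i> * of_real t) ^ n = (- \<i>) ^ n * of_real t ^ n"
      by (rule power_mult_distrib)
    then show ?thesis
      by (simp add: moment_kernel_def wave_def exp_minus mult_ac)
  qed
  then have "moment n (a k) (wave a k) = of_real (bump_moment n (bump_pos k)) * ((- \<i>) ^ n * of_real (amp k))"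
    unfolding moment_wave bump_moment_def integral_complex_of_real[symmetric] by simp
  then have "cmod (moment n (a k) (wave a k)) = amp k * \<bar>bump_moment n (bump_pos k)\<bar>"
    using amp_pos[of k] by (simp add: norm_mult norm_power)
  then show ?thesis
    using amp_pos[of k] bump_moment_bounds(1)[OF bump_pos_ge1, where n = n and k1 = k]
    by (auto intro!: mult_left_mono)
qed

text \<open>Sum and integral may be exchanged because the integrals of the norms are dominated by
  the summable \<open>amp k * (2 * bump_pos k) ^ n\<close>.\<close>

lemma moment_wave_sum: "(\<lambda>k. moment n \<alpha> (wave a k)) sums moment n \<alpha> (wave_sum a)"
proof -
  have "(\<lambda>k. \<integral>t. moment_kernel n \<alpha> t * wave a k t \<partial>lborel) sums
      (\<integral>t. (\<Sum>k. moment_kernel n \<alpha> t * wave a k t) \<partial>lborel)"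
  proof (rule sums_integral)
    show "integrable lborel (\<lambda>t. moment_kernel n \<alpha> t * wave a k t)" for k
      by (rule integrable_moment_wave)
    show "AE t in lborel. summable (\<lambda>k. norm (moment_kernel n \<alpha> t * wave a k t))"
      unfolding norm_mult by (intro AE_I2 summable_mult summable_norm_wave)
    show "summable (\<lambda>k. \<integral>t. norm (moment_kernel n \<alpha> t * wave a k t) \<partial>lborel)"
      unfolding integral_norm_moment_wave
    proof (rule summable_comparison_test'[OF summable_amp_power[of n], of 0])
      show "norm (amp k * bump_moment n (bump_pos k)) \<le> amp k * (2 * bump_pos k) ^ n" for k
      proof -
        have "0 \<le> bump_pos k ^ n"
          using bump_pos_ge1[of k] by simp
        then have "0 \<le> bump_moment n (bump_pos k)"
          using bump_moment_bounds(1)[OF bump_pos_ge1[of k], of n] by linarith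
        then show ?thesis
          using bump_moment_bounds(2)[OF bump_pos_ge1[of k], of n] amp_pos[of k]
          by (simp add: abs_mult)
      qed
    qed
  qed
  \<comment> \<open>The waves vanish for \<open>t < 0\<close>, so the integral over the line is the
    half-line integral defining the moment.\<close>
  moreover have "(\<Sum>k. moment_kernel n \<alpha> t * wave a k t)
      = indicator {0..} t *\<^sub>R (moment_kernel n \<alpha> t * wave_sum a t)" for t
    by (cases "t \<ge> 0")
      (auto simp: wave_eq_0 wave_sum_def suminf_mult summable_norm_cancel[OF summable_norm_wave])
  ultimately show ?thesis
    by (simp add: moment_wave) (simp add: moment_def set_lebesgue_integral_def)
qed

text \<open>The k-th wave contributes at least \<open>bump_pos k\<close>, the earlier ones at most
  the sum in the recursion of \<open>bump_pos\<close>, the later ones at most 2; the recursion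
  leaves the stated amount.\<close>

lemma norm_moment_wave_sum_ge:
  fixes k :: nat
  defines "n \<equiv> 2 * k + 2"
  shows "fact n * real n ^ (k * n) \<le> cmod (moment n (a k) (wave_sum a))"
proof -
  let ?m = "\<lambda>j. moment n (a k) (wave a j)"
  have sm: "summable ?m"
    using moment_wave_sum by (rule sums_summable)
  define R where "R = (\<Sum>j. ?m (j + Suc k))"
  have split: "moment n (a k) (wave_sum a) = R + ((\<Sum>j<k. ?m j) + ?m k)"
    using suminf_split_initial_segment[OF sm, of "Suc k"] sums_unique[OF moment_wave_sum, of n "a k" a]
    by (simp add: R_def)
  have main: "bump_pos k \<le> cmod (?m k)"
  proof -
    have "amp k * bump_pos k ^ n = bump_pos k"
      using bump_pos_ge1[of k] by (simp add: amp_def n_def field_simps)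
    then show ?thesis
      using norm_moment_wave_ge[of k n a] by simp
  qed
  have low: "cmod (\<Sum>j<k. ?m j) \<le> (\<Sum>j<k. (2 * bump_pos j) ^ n)"
  proof (rule order_trans[OF norm_sum sum_mono])
    fix j
    have "amp j \<le> 1"
      using one_le_power[OF bump_pos_ge1[of j], of "2 * j + 1"]
      unfolding amp_def inverse_le_1_iff by blast
    then have "amp j * (2 * bump_pos j) ^ n \<le> 1 * (2 * bump_pos j) ^ n"
      using bump_pos_ge1[of j] by (intro mult_right_mono) auto
    with norm_moment_wave_le[of n "a k" a j] show "cmod (?m j) \<le> (2 * bump_pos j) ^ n"
      by linarith
  qed
  have high: "cmod R \<le> 2"
  proof -
    have b: "cmod (?m (j + Suc k)) \<le> (1 / 2) ^ j" for j
    proof -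
      \<comment> \<open>For \<open>j = 0\<close> this is an equality, so \<open>amp_power_le\<close>
        covers every wave after the k-th.\<close>
      have "n \<le> 2 * (j + Suc k)"
        by (simp add: n_def)
      then have "cmod (?m (j + Suc k)) \<le> inverse (2 ^ (j + Suc k))"
        using norm_moment_wave_le[of n "a k" a "j + Suc k"] amp_power_le by (meson order_trans)
      also have "\<dots> \<le> inverse (2 ^ j)"
        by (intro le_imp_inverse_le power_increasing) auto
      finally show ?thesis
        by (simp add: power_one_over inverse_eq_divide)
    qed
    have g: "(\<lambda>j. (1 / 2) ^ j :: real) sums 2"
      using geometric_sums[of "1 / 2 :: real"] by simp
    have s: "summable (\<lambda>j. cmod (?m (j + Suc k)))"
      using b by (intro summable_comparison_test'[OF sums_summable[OF g], of 0]) auto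
    have "cmod R \<le> (\<Sum>j. cmod (?m (j + Suc k)))"
      unfolding R_def using s by (rule summable_norm)
    also have "\<dots> \<le> (\<Sum>j. (1 / 2) ^ j)"
      using b s sums_summable[OF g] by (intro suminf_le)
    finally show ?thesis
      using sums_unique[OF g] by simp
  qed
  have "cmod (?m k) \<le> cmod (moment n (a k) (wave_sum a)) + cmod R + cmod (\<Sum>j<k. ?m j)"
    using norm_triangle_ineq4[of "moment n (a k) (wave_sum a)" "R + (\<Sum>j<k. ?m j)"]
      norm_triangle_ineq[of R "\<Sum>j<k. ?m j"] by (simp add: split algebra_simps)
  \<comment> \<open>The summand 3 absorbs the tail bound 2.\<close>
  moreover have "bump_pos k = (\<Sum>j<k. (2 * bump_pos j) ^ n) + 8 ^ k + 3 + fact n * real n ^ (k * n)"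
    unfolding n_def by (rule bump_pos.simps)
  ultimately show ?thesis
    using main low high zero_le_power[of "8::real" k] by linarith
qed

subsection \<open>Topology and perturbation\<close>

lemma openin_\<rho>_ball:
  "f \<in> S0 \<Longrightarrow> e > 0 \<Longrightarrow> openin S0_topology {g \<in> S0. \<rho> l (\<lambda>t. g t - f t) < e}"
  unfolding S0_topology_def by (rule topology_generated_by_Basis) blast

lemma mem_\<rho>_ball_self: "f \<in> S0 \<Longrightarrow> e > 0 \<Longrightarrow> f \<in> {g \<in> S0. \<rho> l (\<lambda>t. g t - f t) < e}"
  by (simp add: \<rho>_def)

lemma continuous_map_moment: "continuous_map S0_topology euclidean (moment n \<alpha>)"
  unfolding continuous_map_def
proof (intro conjI allI impI)
  fix U :: "complex set" assume "openin euclidean U"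
  then have U: "open U"
    by simp
  show "openin S0_topology {f \<in> topspace S0_topology. moment n \<alpha> f \<in> U}"
  proof (subst openin_subopen, intro ballI)
    fix f assume "f \<in> {f \<in> topspace S0_topology. moment n \<alpha> f \<in> U}"
    then have f: "f \<in> S0" "moment n \<alpha> f \<in> U"
      by auto
    with U obtain e where e: "e > 0" "ball (moment n \<alpha> f) e \<subseteq> U"
      using open_contains_ball by blast
    \<comment> \<open>Two seminorms below \<open>e / pi\<close>, times the factor
      \<open>pi / 2\<close>, stay below \<open>e\<close> in total.\<close>
    define B where "B l = {g \<in> S0. \<rho> l (\<lambda>t. g t - f t) < e / pi}" for l
    have "moment n \<alpha> g \<in> U" if g: "g \<in> B n \<inter> B (n + 2)" for g
    proof -
      have rg: "rapid g" "rapid f"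
        using f g by (auto simp: B_def rapid_if_S0)
      have "cmod (moment n \<alpha> g - moment n \<alpha> f)
          \<le> pi / 2 * (\<rho> n (\<lambda>t. g t - f t) + \<rho> (n + 2) (\<lambda>t. g t - f t))"
        unfolding moment_diff[OF rg, symmetric] by (intro norm_moment_le rapid_diff rg)
      also have "\<dots> < pi / 2 * (e / pi + e / pi)"
        using g by (intro mult_strict_left_mono add_strict_mono) (auto simp: B_def)
      finally have "moment n \<alpha> g \<in> ball (moment n \<alpha> f) e"
        by (simp add: dist_norm norm_minus_commute)
      with e(2) show ?thesis
        by blast
    qed
    then have "B n \<inter> B (n + 2) \<subseteq> {f \<in> topspace S0_topology. moment n \<alpha> f \<in> U}"
      by (auto simp: B_def)
    moreover have "openin S0_topology (B n \<inter> B (n + 2))" "f \<in> B n \<inter> B (n + 2)"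
      using f(1) e(1) openin_\<rho>_ball[of f "e / pi"] mem_\<rho>_ball_self[of f "e / pi"]
      unfolding B_def by (simp_all only: openin_Int IntI pi_gt_zero divide_pos_pos)
    ultimately show "\<exists>T. openin S0_topology T \<and> f \<in> T \<and> T \<subseteq> {f \<in> topspace S0_topology. moment n \<alpha> f \<in> U}"
      by blast
  qed
qed auto

text \<open>For fixed \<open>n\<close> the number \<open>K M f \<alpha> n\<close> depends
  continuously on \<open>moment n \<alpha> f\<close>, which is continuous in
  \<open>f\<close>.\<close>

lemma openin_K_greater: "openin S0_topology {f \<in> S0. K M f \<alpha> n > c}"
proof -
  let ?U = "{z :: complex. c < 1 / real n ^ M * root n (cmod z / fact n)}"
  have "open ?U"
    by (intro open_Collect_less continuous_intros) auto
  then have "openin S0_topology {f \<in> topspace S0_topology. moment n \<alpha> f \<in> ?U}"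
    by (intro openin_continuous_map_preimage[OF continuous_map_moment]) simp
  moreover have "{f \<in> topspace S0_topology. moment n \<alpha> f \<in> ?U} = {f \<in> S0. K M f \<alpha> n > c}"
    by (auto simp: K_eq)
  ultimately show ?thesis
    by simp
qed

text \<open>Thresholds are natural numbers so that the condition becomes a countable
  intersection.\<close>

lemma limsup_ereal_eq_PInf_iff:
  fixes u :: "nat \<Rightarrow> real"
  shows "limsup (\<lambda>n. ereal (u n)) = \<infinity> \<longleftrightarrow> (\<forall>(c::nat) N. \<exists>n\<ge>N. u n > real c)"
proof -
  have "limsup (\<lambda>n. ereal (u n)) = \<infinity> \<longleftrightarrow> (\<forall>N. \<forall>x<\<infinity>. \<exists>n\<ge>N. x < ereal (u n))"
    unfolding limsup_INF_SUP top_ereal_def[symmetric] INF_top_conv SUP_eq_top_iff by auto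
  also have "\<dots> \<longleftrightarrow> (\<forall>(c::nat) N. \<exists>n\<ge>N. u n > real c)"
  proof (intro iffI allI impI)
    fix c N :: nat assume "\<forall>N. \<forall>x<\<infinity>. \<exists>n\<ge>N. x < ereal (u n)"
    then show "\<exists>n\<ge>N. u n > real c"
      by (metis less_ereal.simps(1) less_ereal.simps(4) PInfty_neq_ereal(1))
  next
    fix N and x :: ereal assume *: "\<forall>(c::nat) N. \<exists>n\<ge>N. u n > real c" and "x < \<infinity>"
    then obtain c :: nat where "x < ereal (real c)"
      using less_PInf_Ex_of_nat by auto
    with * show "\<exists>n\<ge>N. x < ereal (u n)"
      by (meson less_ereal.simps(1) less_trans)
  qed
  finally show ?thesis .
qed

section \<open>Perturbations along a line through \<open>f\<close>\<close>

definition perturb :: "(real \<Rightarrow> complex) \<Rightarrow> (real \<Rightarrow> complex) \<Rightarrow> real \<Rightarrow> real \<Rightarrow> complex" where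
  "perturb f g \<epsilon> = (\<lambda>t\<in>{0..}. f t + of_real \<epsilon> * g t)"

lemma perturb_in_S0:
  assumes "f \<in> S0" "rapid g"
  shows "perturb f g \<epsilon> \<in> S0"
proof -
  have "rapid (\<lambda>t. f t + of_real \<epsilon> * g t)"
    by (intro rapid_add rapid_cmult rapid_if_S0[OF assms(1)] assms(2))
  then have "rapid (perturb f g \<epsilon>)"
    by (rule rapid_cong[rotated]) (simp add: perturb_def)
  then show ?thesis
    by (simp add: S0_def rapid_def perturb_def)
qed

lemma perturb_0: "f \<in> S0 \<Longrightarrow> perturb f g 0 = f"
  by (auto simp: perturb_def S0_def extensional_def restrict_def)

lemma moment_perturb:
  assumes "f \<in> S0" "rapid g"
  shows "moment n \<alpha> (perturb f g \<epsilon>) = moment n \<alpha> f + of_real \<epsilon> * moment n \<alpha> g"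
proof -
  have "moment n \<alpha> (perturb f g \<epsilon>) = moment n \<alpha> (\<lambda>t. f t + of_real \<epsilon> * g t)"
    by (rule moment_cong) (simp add: perturb_def)
  then show ?thesis
    using assms by (simp add: moment_add moment_cmult rapid_cmult rapid_if_S0)
qed

text \<open>By the triangle inequality the seminorm is Lipschitz in \<epsilon> with constant
  \<open>\<rho> l g\<close>.\<close>

lemma continuous_on_\<rho>_line:
  assumes f: "rapid f" and g: "rapid g"
  shows "continuous_on UNIV (\<lambda>\<epsilon>. \<rho> l (\<lambda>t. f t + of_real \<epsilon> * g t))" (is "continuous_on UNIV ?r")
proof (rule lipschitz_on_continuous_on[of "\<rho> l g"], rule lipschitz_onI)
  have le: "?r x \<le> ?r y + \<bar>x - y\<bar> * \<rho> l g" for x y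
  proof -
    have "?r x = \<rho> l (\<lambda>t. (f t + of_real y * g t) + of_real (x - y) * g t)"
      by (rule \<rho>_cong) (simp add: algebra_simps)
    also have "\<dots> \<le> ?r y + \<rho> l (\<lambda>t. of_real (x - y) * g t)"
      using f g by (intro \<rho>_triangle rapid_add rapid_cmult)
    finally show ?thesis
      using \<rho>_cmult[OF g, of l "of_real (x - y)"] by (simp only: norm_of_real)
  qed
  show "dist (?r x) (?r y) \<le> \<rho> l g * dist x y" for x y
    using le[of x y] le[of y x] by (simp add: dist_real_def abs_minus_commute mult.commute)
qed (rule \<rho>_nonneg[OF g])

lemma continuous_map_perturb:
  assumes f: "f \<in> S0" and g: "rapid g"
  shows "continuous_map euclideanreal S0_topology (perturb f g)"
  unfolding S0_topology_def
proof (rule continuous_on_generated_topo)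
  fix U assume "U \<in> {{g \<in> S0. \<rho> l (\<lambda>t. g t - f t) < e} |l f e. f \<in> S0 \<and> e > 0}"
  then obtain l h e where U: "U = {g \<in> S0. \<rho> l (\<lambda>t. g t - h t) < e}" and h: "h \<in> S0"
    by blast
  \<comment> \<open>The ball is centred at an arbitrary \<open>h\<close>, so its preimage concerns
    the line through \<open>f - h\<close>.\<close>
  have "\<rho> l (\<lambda>t. perturb f g \<epsilon> t - h t) = \<rho> l (\<lambda>t. (f t - h t) + of_real \<epsilon> * g t)" for \<epsilon>
    by (rule \<rho>_cong) (simp add: perturb_def)
  then have "perturb f g -` U = {\<epsilon>. \<rho> l (\<lambda>t. (f t - h t) + of_real \<epsilon> * g t) < e}"
    using perturb_in_S0[OF f g] by (auto simp: U)
  moreover have "open {\<epsilon>. \<rho> l (\<lambda>t. (f t - h t) + of_real \<epsilon> * g t) < e}"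
    by (intro open_Collect_less continuous_on_\<rho>_line rapid_diff rapid_if_S0[OF f]
        rapid_if_S0[OF h] g continuous_on_const)
  ultimately show "openin euclideanreal (perturb f g -` U \<inter> topspace euclideanreal)"
    by simp
next
  show "perturb f g ` topspace euclideanreal \<subseteq> \<Union> {{g \<in> S0. \<rho> l (\<lambda>t. g t - f t) < e} |l f e. f \<in> S0 \<and> e > 0}"
    unfolding topology_generated_by_topspace[symmetric] S0_topology_def[symmetric]
    using perturb_in_S0[OF f g] by auto
qed

section \<open>Uniqueness of the exceptional parameter\<close>

lemma norm_moment_le_if_K_le:
  assumes "f \<in> S0" "n \<ge> 1" "K M f \<alpha> n \<le> c"
  shows "cmod (moment n \<alpha> f) \<le> fact n * (c * real n ^ M) ^ n"
proof -
  let ?x = "cmod (moment n \<alpha> f) / fact n"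
  have "root n ?x \<le> c * real n ^ M"
    using assms by (simp add: K_eq field_simps)
  then have "root n ?x ^ n \<le> (c * real n ^ M) ^ n"
    by (intro power_mono real_root_ge_zero) auto
  then have "?x \<le> (c * real n ^ M) ^ n"
    using assms(2) by simp
  then show ?thesis
    by (simp add: field_simps)
qed

text \<open>The lower bound at order \<open>n = 2 * k + 2\<close> carries the exponent
  \<open>k * n\<close>, and \<open>k\<close> is unbounded along the occurrences of \<alpha>, so it
  outruns the fixed \<open>M\<close>.\<close>

lemma wave_growth_contradiction:
  assumes io: "\<And>K. \<exists>k\<ge>K. a k = \<alpha>"
    and bound: "\<And>n. n \<ge> N \<Longrightarrow>
      cmod (moment n \<alpha> (wave_sum a)) \<le> B * (fact n * (real c * real n ^ M) ^ n)"
  shows False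
proof -
  obtain b :: nat where b: "max B 0 < real b"
    using reals_Archimedean2 by blast
  \<comment> \<open>The summand \<open>M + 2\<close> leaves two spare factors \<open>n ^ n\<close>;
    \<open>b\<close> and \<open>c\<close> let these absorb \<open>B\<close> and
    \<open>c ^ n\<close>; \<open>N\<close> brings \<open>n\<close> into the range of
    \<open>bound\<close>.\<close>
  obtain k where k: "k \<ge> M + 2 + N + b + c" "a k = \<alpha>"
    using io by blast
  define n where "n = 2 * k + 2"
  have n: "n \<ge> N" "n \<ge> b" "n \<ge> c" "n \<ge> 1" "k \<ge> M + 2"
    using k by (auto simp: n_def)
  have "B * real c ^ n < real n ^ n * real n ^ n"
  proof -
    have "B < real n ^ n"
    proof -
      have "real n \<le> real n ^ n"
        using n by (intro self_le_power) auto
      with b n(2) show ?thesis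
        by linarith
    qed
    moreover have "real c ^ n \<le> real n ^ n"
      using n by (intro power_mono) auto
    moreover have "0 < real n ^ n"
      using n by simp
    moreover have "B * real c ^ n \<le> max B 0 * real n ^ n"
      using \<open>real c ^ n \<le> real n ^ n\<close> by (intro mult_mono) auto
    moreover have "max B 0 * real n ^ n < real n ^ n * real n ^ n"
      using \<open>B < real n ^ n\<close> \<open>0 < real n ^ n\<close> by (intro mult_strict_right_mono) auto
    ultimately show ?thesis
      by linarith
  qed
  then have "B * real c ^ n * real n ^ (M * n) < real n ^ n * real n ^ n * real n ^ (M * n)"
    using n by (intro mult_strict_right_mono) auto
  also have "\<dots> = real n ^ ((M + 2) * n)"
    by (simp add: power_add[symmetric] algebra_simps)
  also have "\<dots> \<le> real n ^ (k * n)"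
    using n by (intro power_increasing mult_le_mono) auto
  finally have "fact n * (B * real c ^ n * real n ^ (M * n)) < fact n * real n ^ (k * n)"
    by (intro mult_strict_left_mono) auto
  also have "\<dots> \<le> cmod (moment n \<alpha> (wave_sum a))"
    using norm_moment_wave_sum_ge[of k a] k(2) by (simp add: n_def)
  also have "\<dots> \<le> B * (fact n * (real c * real n ^ M) ^ n)"
    by (rule bound[OF n(1)])
  also have "\<dots> = fact n * (B * real c ^ n * real n ^ (M * n))"
    by (simp add: power_mult_distrib power_mult)
  finally show False
    by simp
qed

text \<open>A finite upper limit bounds the moments from some order on; two such bounds would bound
  those of \<open>wave_sum a\<close>, against \<open>wave_growth_contradiction\<close>.\<close>

lemma perturb_parameter_unique:
  assumes f: "f \<in> S0" and io: "\<And>K. \<exists>k\<ge>K. a k = \<alpha>"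
    and x: "limsup (\<lambda>n. ereal (K M (perturb f (wave_sum a) x) \<alpha> n)) \<noteq> \<infinity>"
    and y: "limsup (\<lambda>n. ereal (K M (perturb f (wave_sum a) y) \<alpha> n)) \<noteq> \<infinity>"
  shows "x = y"
proof (rule ccontr)
  assume "x \<noteq> y"
  let ?g = "wave_sum a" and ?p = "perturb f (wave_sum a)"
  obtain c1 N1 c2 N2 :: nat
    where c1: "\<And>n. n \<ge> N1 \<Longrightarrow> K M (?p x) \<alpha> n \<le> real c1"
      and c2: "\<And>n. n \<ge> N2 \<Longrightarrow> K M (?p y) \<alpha> n \<le> real c2"
    using x y unfolding limsup_ereal_eq_PInf_iff by (meson linorder_not_less)
  define c where "c = max c1 c2"
  show False
  \<comment> \<open>Order at least 1 lets the root be undone; the 2 comes from the triangle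
    inequality, \<open>\<bar>x - y\<bar>\<close> from the factor left after subtraction.\<close>
  proof (rule wave_growth_contradiction[OF io, where N = "max (max N1 N2) 1" and B = "2 / \<bar>x - y\<bar>"])
    fix n assume n: "n \<ge> max (max N1 N2) 1"
    let ?C = "fact n * (real c * real n ^ M) ^ n"
    have "K M (?p x) \<alpha> n \<le> real c" "K M (?p y) \<alpha> n \<le> real c"
      using n c1[of n] c2[of n] by (auto simp: c_def max_def split: if_splits)
    then have le: "cmod (moment n \<alpha> (?p x)) \<le> ?C" "cmod (moment n \<alpha> (?p y)) \<le> ?C"
      using n perturb_in_S0[OF f rapid_wave_sum] by (auto intro!: norm_moment_le_if_K_le)
    have "moment n \<alpha> (?p x) - moment n \<alpha> (?p y) = of_real (x - y) * moment n \<alpha> ?g"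
      by (simp add: moment_perturb[OF f rapid_wave_sum] algebra_simps)
    then have "\<bar>x - y\<bar> * cmod (moment n \<alpha> ?g) = cmod (moment n \<alpha> (?p x) - moment n \<alpha> (?p y))"
      by (simp only: norm_mult norm_of_real)
    also have "\<dots> \<le> 2 * ?C"
      using norm_triangle_ineq4[of "moment n \<alpha> (?p x)" "moment n \<alpha> (?p y)"] le by linarith
    finally show "cmod (moment n \<alpha> ?g) \<le> 2 / \<bar>x - y\<bar> * ?C"
      using \<open>x \<noteq> y\<close> by (simp add: field_simps)
  qed
qed

text \<open>Decoding \<open>k\<close> as a pair and keeping the first component repeats each index
  infinitely often; \<open>prod_encode (i, N) \<ge> N\<close> is a late occurrence.\<close>

lemma infinitely_often_enumeration:
  assumes "countable A" "A \<noteq> {}"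
  shows "\<exists>a :: nat \<Rightarrow> 'a. \<forall>x\<in>A. \<forall>N. \<exists>k\<ge>N. a k = x"
proof (intro exI[of _ "from_nat_into A \<circ> fst \<circ> prod_decode"] ballI allI)
  fix x N assume "x \<in> A"
  then obtain i where "from_nat_into A i = x"
    using assms by (metis from_nat_into_surj)
  then show "\<exists>k\<ge>N. (from_nat_into A \<circ> fst \<circ> prod_decode) k = x"
    by (intro exI[of _ "prod_encode (i, N)"]) (simp add: le_prod_encode_2)
qed

section \<open>Density by a line of perturbations, and countably many open conditions\<close>

theorem theorem3:
  fixes A :: "real set"
  assumes "countable A" and "closure A = UNIV"
  defines "\<B> \<equiv> {f \<in> S0. \<forall>M\<ge>1. \<forall>\<alpha>\<in>A. limsup (\<lambda>n. ereal (K M f \<alpha> n)) = \<infinity>}"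
  shows "S0_topology closure_of \<B> = topspace S0_topology \<and> gdelta_in S0_topology \<B>"
proof
  have "A \<noteq> {}"
    using assms(2) by auto
  from infinitely_often_enumeration[OF assms(1) this]
  obtain a :: "nat \<Rightarrow> real" where a: "\<forall>\<alpha>\<in>A. \<forall>N. \<exists>k\<ge>N. a k = \<alpha>"
    by (rule exE)
  have io: "\<exists>k\<ge>N. a k = \<alpha>" if "\<alpha> \<in> A" for \<alpha> N
    using a that by blast
  show "S0_topology closure_of \<B> = topspace S0_topology"
    unfolding dense_intersects_open
  proof (intro allI impI)
    fix T assume T: "openin S0_topology T \<and> T \<noteq> {}"
    then obtain f where "f \<in> T"
      by blast
    with T have f: "f \<in> S0"
      using openin_subset by fastforce
    let ?p = "perturb f (wave_sum a)"
    \<comment> \<open>Countably many pairs \<open>(\<alpha>, M)\<close>, each contributing at most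
      one parameter.\<close>
    define bad where "bad = (\<Union>\<alpha>\<in>A. \<Union>M. {\<epsilon>. limsup (\<lambda>n. ereal (K M (?p \<epsilon>) \<alpha> n)) \<noteq> \<infinity>})"
    have "countable bad"
      unfolding bad_def
    proof (intro countable_UN assms(1) countableI_type)
      fix \<alpha> M assume "\<alpha> \<in> A"
      then have "\<exists>x. {\<epsilon>. limsup (\<lambda>n. ereal (K M (?p \<epsilon>) \<alpha> n)) \<noteq> \<infinity>} \<subseteq> {x}"
        using perturb_parameter_unique[OF f io] by blast
      then show "countable {\<epsilon>. limsup (\<lambda>n. ereal (K M (?p \<epsilon>) \<alpha> n)) \<noteq> \<infinity>}"
        by (meson countable_empty countable_insert countable_subset)
    qed
    moreover have "uncountable {\<epsilon>. ?p \<epsilon> \<in> T}"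
    proof -
      \<comment> \<open>The preimage of \<open>T\<close> is open and contains 0, hence contains an
        interval, which no countable set exhausts.\<close>
      have "open {\<epsilon>. ?p \<epsilon> \<in> T}"
        using openin_continuous_map_preimage[OF continuous_map_perturb[OF f rapid_wave_sum[of a]]] T
        by fastforce
      moreover have "0 \<in> {\<epsilon>. ?p \<epsilon> \<in> T}"
        using \<open>f \<in> T\<close> f by (simp add: perturb_0)
      ultimately obtain e where "e > 0" "ball 0 e \<subseteq> {\<epsilon>. ?p \<epsilon> \<in> T}"
        using open_contains_ball by blast
      then show ?thesis
        using uncountable_ball countable_subset by blast
    qed
    ultimately obtain \<epsilon> where "?p \<epsilon> \<in> T" "\<epsilon> \<notin> bad"
      by (metis countable_subset mem_Collect_eq subsetI)
    then have "?p \<epsilon> \<in> \<B> \<inter> T"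
      using perturb_in_S0[OF f rapid_wave_sum] by (auto simp: \<B>_def bad_def)
    then show "\<B> \<inter> T \<noteq> {}"
      by blast
  qed
  define G where "G = (\<lambda>(M, \<alpha>, c::nat, N). {f \<in> S0. \<exists>n\<ge>N. K M f \<alpha> n > real c})"
  \<comment> \<open>Nonemptiness of \<open>A\<close> matters here: an empty intersection would be
    \<open>UNIV\<close> instead of \<open>S0\<close>.\<close>
  have "\<B> = \<Inter> (G ` ({1..} \<times> A \<times> UNIV \<times> UNIV))"
    using \<open>A \<noteq> {}\<close> by (auto simp: \<B>_def G_def limsup_ereal_eq_PInf_iff)
  moreover have "gdelta_in S0_topology (G p)" for p
  proof -
    obtain M \<alpha> c N where p: "p = (M, \<alpha>, c, N)"
      by (cases p)
    have "G p = (\<Union>n\<in>{N..}. {f \<in> S0. K M f \<alpha> n > real c})"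
      by (auto simp: G_def p)
    then show ?thesis
      by (auto intro!: open_imp_gdelta_in openin_K_greater)
  qed
  ultimately show "gdelta_in S0_topology \<B>"
    using assms(1) \<open>A \<noteq> {}\<close> by (auto intro!: gdelta_in_Inter countable_image countable_SIGMA)
qed

end
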